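(* Let $X$ be a Hadamard manifold. For any Borel probability measures $\mathbb{P}$ and $\mathbb{Q}$ on $X$ and any $z\in X$, $$\bigl|D(z;\mathbb{P})-D(z;\mathbb{Q})\bigr|\le \|\mathbb{P}-\mathbb{Q}\|_{\mathrm{TV}}.$$
   Context: A Hadamard manifold is a complete simply connected finite-dimensional Riemannian manifold of nonpositive sectional curvature, with Riemannian distance $d(\cdot,\cdot)$. Its visual boundary $\partial X$ is the set of equivalence classes $\gamma(\infty)$ of unit-speed geodesic rays $\gamma:[0,\infty)\to X$, where $\gamma,\gamma'$ are equivalent if $\sup_{t\ge0}d(\gamma(t),\gamma'(t))<\infty$. Fix an origin $o\in X$. For $\xi\in\partial X$ the Busemann function is $B_\xi(x):=\lim_{t\to\infty}(d(\gamma(t),x)-t)$, where $\gamma$ is the unique unit-speed geodesic ray with $\gamma(0)=o$, $\gamma(\infty)=\xi$ (another choice of $o$ changes $B_\xi$ by an additive constant). For $z\in X$ let $H^+_{\xi,z}:=\{x\in X:B_\xi(x)\ge B_\xi(z)\}$. The horospherical depth is $D(z;\mathbb{P}):=\inf_{\xi\in\partial X}\mathbb{P}(H^+_{\xi,z})$. Total variation is normalized as $\|\mathbb{P}-\mathbb{Q}\|_{\mathrm{TV}}:=\sup_{A}|\mathbb{P}(A)-\mathbb{Q}(A)|$, the supremum over Borel sets $A\subset X$. *)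

theory Defs
  imports "HOL-Analysis.Analysis" "HOL-Probability.Probability"
begin

section \<open>Smooth maps and smooth manifolds\<close>

text \<open>On an open subset of a Euclidean space, a map is \<open>C\<^sup>k\<close> iff all its iterated directional
  derivatives up to order \<open>k\<close> exist as Frechet derivatives and are continuous.\<close>

fun Ck_on :: "nat \<Rightarrow> 'a::real_normed_vector set \<Rightarrow> ('a \<Rightarrow> 'b::real_normed_vector) \<Rightarrow> bool" where
  "Ck_on 0 S f \<longleftrightarrow> continuous_on S f"
| "Ck_on (Suc k) S f \<longleftrightarrow>
     (\<forall>x\<in>S. f differentiable (at x)) \<and>
     (\<forall>v. Ck_on k S (\<lambda>x. frechet_derivative f (at x) v))"

definition smooth_on :: "'a::real_normed_vector set \<Rightarrow> ('a \<Rightarrow> 'b::real_normed_vector) \<Rightarrow> bool" where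
  "smooth_on S f \<longleftrightarrow> (\<forall>k. Ck_on k S f)"

text \<open>The manifold is a topological type \<open>'x\<close>. A chart is a domain together with a coordinate map;
  values of the coordinate map outside the domain are irrelevant. The model space
  \<open>'e\<close> is an arbitrary Euclidean space, and \<open>DIM('e)\<close> is the dimension of the manifold.\<close>

type_synonym ('x, 'e) chart = "'x set \<times> ('x \<Rightarrow> 'e)"

definition is_chart :: "('x::topological_space, 'e::euclidean_space) chart \<Rightarrow> bool" where
  "is_chart c \<longleftrightarrow> (case c of (U, \<phi>) \<Rightarrow>
     open U \<and> open (\<phi> ` U) \<and> homeomorphism U (\<phi> ` U) \<phi> (inv_into U \<phi>))"

definition transition :: "('x, 'e) chart \<Rightarrow> ('x, 'e) chart \<Rightarrow> 'e \<Rightarrow> 'e" where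
  "transition c c' = snd c' \<circ> inv_into (fst c) (snd c)"

text \<open>The Hausdorff and second countability axioms are the type classes of \<open>'x\<close>.\<close>

definition smooth_atlas ::
  "('x::{t2_space, second_countable_topology}, 'e::euclidean_space) chart set \<Rightarrow> bool" where
  "smooth_atlas A \<longleftrightarrow>
     (\<forall>c\<in>A. is_chart c) \<and>
     (\<Union>c\<in>A. fst c) = UNIV \<and>
     (\<forall>c\<in>A. \<forall>c'\<in>A. smooth_on (snd c ` (fst c \<inter> fst c')) (transition c c'))"

section \<open>Riemannian metrics\<close>

text \<open>The metric tensor is given by its coordinate expressions: \<open>g c p\<close> is the inner product on
  tangent vectors at the point of coordinates \<open>p\<close> in the chart \<open>c\<close>, the tangent space there being
  identified with \<open>'e\<close> through \<open>c\<close>. The last clause is the tensor transformation law.\<close>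

type_synonym ('x, 'e) metric_tensor = "('x, 'e) chart \<Rightarrow> 'e \<Rightarrow> 'e \<Rightarrow> 'e \<Rightarrow> real"

definition inner_product_form :: "('e::real_vector \<Rightarrow> 'e \<Rightarrow> real) \<Rightarrow> bool" where
  "inner_product_form B \<longleftrightarrow>
     bilinear B \<and> (\<forall>v w. B v w = B w v) \<and> (\<forall>v. v \<noteq> 0 \<longrightarrow> B v v > 0)"

definition riemannian_manifold ::
  "('x::{t2_space, second_countable_topology}, 'e::euclidean_space) chart set
     \<Rightarrow> ('x, 'e) metric_tensor \<Rightarrow> bool" where
  "riemannian_manifold A g \<longleftrightarrow>
     smooth_atlas A \<and>
     (\<forall>c\<in>A. \<forall>p \<in> snd c ` fst c. inner_product_form (g c p)) \<and>
     (\<forall>c\<in>A. \<forall>v w. smooth_on (snd c ` fst c) (\<lambda>p. g c p v w)) \<and>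
     (\<forall>c\<in>A. \<forall>c'\<in>A. \<forall>x \<in> fst c \<inter> fst c'. \<forall>v w.
        (let D = frechet_derivative (transition c c') (at (snd c x))
         in g c (snd c x) v w = g c' (snd c' x) (D v) (D w)))"

section \<open>Levi-Civita connection and sectional curvature\<close>

text \<open>In this section \<open>G\<close> is the coordinate expression of the metric in one chart.
  \<open>christoffel G p v w\<close> is the covariant derivative, in direction \<open>v\<close>, of the coordinate vector field
  with constant value \<open>w\<close>, i.e. the vector with components
  \<open>\<Gamma>\<^sup>k\<^sub>i\<^sub>j v\<^sup>i w\<^sup>j\<close>. It is determined by Koszul's formula, in which all Lie brackets
  vanish for constant fields.\<close>

definition christoffel ::
  "('e::euclidean_space \<Rightarrow> 'e \<Rightarrow> 'e \<Rightarrow> real) \<Rightarrow> 'e \<Rightarrow> 'e \<Rightarrow> 'e \<Rightarrow> 'e" where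
  "christoffel G p v w = (THE u. \<forall>z.
     2 * G p u z = frechet_derivative (\<lambda>q. G q w z) (at p) v
                 + frechet_derivative (\<lambda>q. G q v z) (at p) w
                 - frechet_derivative (\<lambda>q. G q v w) (at p) z)"

text \<open>\<open>R(u,v)w = \<nabla>\<^sub>u \<nabla>\<^sub>v w - \<nabla>\<^sub>v \<nabla>\<^sub>u w\<close> for constant coordinate fields.\<close>

definition riemann_curvature ::
  "('e::euclidean_space \<Rightarrow> 'e \<Rightarrow> 'e \<Rightarrow> real) \<Rightarrow> 'e \<Rightarrow> 'e \<Rightarrow> 'e \<Rightarrow> 'e \<Rightarrow> 'e" where
  "riemann_curvature G p u v w =
     frechet_derivative (\<lambda>q. christoffel G q v w) (at p) u
     - frechet_derivative (\<lambda>q. christoffel G q u w) (at p) v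
     + christoffel G p u (christoffel G p v w)
     - christoffel G p v (christoffel G p u w)"

definition sectional_curvature ::
  "('e::euclidean_space \<Rightarrow> 'e \<Rightarrow> 'e \<Rightarrow> real) \<Rightarrow> 'e \<Rightarrow> 'e \<Rightarrow> 'e \<Rightarrow> real" where
  "sectional_curvature G p u v =
     G p (riemann_curvature G p u v v) u / (G p u u * G p v v - (G p u v)\<^sup>2)"

definition nonpositive_curvature ::
  "('x, 'e::euclidean_space) chart set \<Rightarrow> ('x, 'e) metric_tensor \<Rightarrow> bool" where
  "nonpositive_curvature A g \<longleftrightarrow>
     (\<forall>c\<in>A. \<forall>p \<in> snd c ` fst c. \<forall>u v.
        u \<noteq> v \<and> independent {u, v} \<longrightarrow> sectional_curvature (g c) p u v \<le> 0)"

section \<open>Riemannian distance\<close>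

definition C1_curve_on ::
  "('x::topological_space, 'e::euclidean_space) chart set \<Rightarrow> real \<Rightarrow> real \<Rightarrow> (real \<Rightarrow> 'x) \<Rightarrow> bool"
  where
  "C1_curve_on A a b \<gamma> \<longleftrightarrow>
     continuous_on {a..b} \<gamma> \<and>
     (\<forall>c\<in>A. let T = {t\<in>{a..b}. \<gamma> t \<in> fst c} in
        \<exists>v. continuous_on T v \<and>
            (\<forall>t\<in>T. ((snd c \<circ> \<gamma>) has_vector_derivative v t) (at t within {a..b})))"

text \<open>\<open>D\<close> is the set of break points; on the closed interval between consecutive break points the
  curve is \<open>C\<^sup>1\<close> up to the ends.\<close>

definition piecewise_C1_curve ::
  "('x::topological_space, 'e::euclidean_space) chart set \<Rightarrow> (real \<Rightarrow> 'x) \<Rightarrow> bool" where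
  "piecewise_C1_curve A \<gamma> \<longleftrightarrow>
     (\<exists>D. finite D \<and>
        (\<forall>a b. 0 \<le> a \<and> a < b \<and> b \<le> 1 \<and> {a<..<b} \<inter> D = {} \<longrightarrow> C1_curve_on A a b \<gamma>))"

text \<open>By the transformation law the speed does not depend on which chart around \<open>\<gamma> t\<close> is chosen.\<close>

definition chart_at :: "('x, 'e) chart set \<Rightarrow> 'x \<Rightarrow> ('x, 'e) chart" where
  "chart_at A x = (SOME c. c \<in> A \<and> x \<in> fst c)"

definition speed ::
  "('x, 'e::euclidean_space) chart set \<Rightarrow> ('x, 'e) metric_tensor \<Rightarrow> (real \<Rightarrow> 'x) \<Rightarrow> real \<Rightarrow> real"
  where
  "speed A g \<gamma> t =
     (let c = chart_at A (\<gamma> t); v = vector_derivative (snd c \<circ> \<gamma>) (at t)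
      in sqrt (g c (snd c (\<gamma> t)) v v))"

definition curve_length ::
  "('x, 'e::euclidean_space) chart set \<Rightarrow> ('x, 'e) metric_tensor \<Rightarrow> (real \<Rightarrow> 'x) \<Rightarrow> real" where
  "curve_length A g \<gamma> = integral {0..1} (speed A g \<gamma>)"

definition riem_dist ::
  "('x::topological_space, 'e::euclidean_space) chart set \<Rightarrow> ('x, 'e) metric_tensor
     \<Rightarrow> 'x \<Rightarrow> 'x \<Rightarrow> real" where
  "riem_dist A g x y =
     Inf {curve_length A g \<gamma> |\<gamma>. piecewise_C1_curve A \<gamma> \<and> \<gamma> 0 = x \<and> \<gamma> 1 = y}"

section \<open>Hadamard manifolds and their visual boundary\<close>

definition hadamard_manifold ::
  "('x::{t2_space, second_countable_topology}, 'e::euclidean_space) chart set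
     \<Rightarrow> ('x, 'e) metric_tensor \<Rightarrow> bool" where
  "hadamard_manifold A g \<longleftrightarrow>
     riemannian_manifold A g \<and>
     Metric_space.mcomplete UNIV (riem_dist A g) \<and>
     simply_connected (UNIV :: 'x set) \<and>
     nonpositive_curvature A g"

text \<open>Unit-speed geodesic rays are solutions of the geodesic equation. They are functions on
  \<open>[0,\<infinity>)\<close>, hence required to be extensional, so that distinct elements are distinct rays.\<close>

definition geodesic_ray ::
  "('x::topological_space, 'e::euclidean_space) chart set \<Rightarrow> ('x, 'e) metric_tensor
     \<Rightarrow> (real \<Rightarrow> 'x) \<Rightarrow> bool" where
  "geodesic_ray A g \<gamma> \<longleftrightarrow>
     \<gamma> \<in> extensional {0..} \<and> continuous_on {0..} \<gamma> \<and>
     (\<forall>c\<in>A. \<exists>v. \<forall>t\<in>{0..}. \<gamma> t \<in> fst c \<longrightarrow>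
        ((snd c \<circ> \<gamma>) has_vector_derivative v t) (at t within {0..}) \<and>
        (v has_vector_derivative - christoffel (g c) (snd c (\<gamma> t)) (v t) (v t))
          (at t within {0..}) \<and>
        g c (snd c (\<gamma> t)) (v t) (v t) = 1)"

definition asymptotic ::
  "('x::topological_space, 'e::euclidean_space) chart set \<Rightarrow> ('x, 'e) metric_tensor
     \<Rightarrow> ((real \<Rightarrow> 'x) \<times> (real \<Rightarrow> 'x)) set" where
  "asymptotic A g =
     {(\<gamma>, \<gamma>'). geodesic_ray A g \<gamma> \<and> geodesic_ray A g \<gamma>' \<and>
        bdd_above ((\<lambda>t. riem_dist A g (\<gamma> t) (\<gamma>' t)) ` {0..})}"

definition visual_boundary ::
  "('x::topological_space, 'e::euclidean_space) chart set \<Rightarrow> ('x, 'e) metric_tensor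
     \<Rightarrow> (real \<Rightarrow> 'x) set set" where
  "visual_boundary A g = {\<gamma>. geodesic_ray A g \<gamma>} // asymptotic A g"

section \<open>Busemann functions and horospherical depth\<close>

text \<open>The origin is written \<open>org\<close>; a boundary point \<open>\<xi>\<close> is an equivalence class, so
  \<open>\<gamma>(\<infinity>) = \<xi>\<close> reads \<open>\<gamma> \<in> \<xi>\<close>.\<close>

definition ray_from :: "'x \<Rightarrow> (real \<Rightarrow> 'x) set \<Rightarrow> real \<Rightarrow> 'x" where
  "ray_from org \<xi> = (THE \<gamma>. \<gamma> \<in> \<xi> \<and> \<gamma> 0 = org)"

definition busemann ::
  "('x::topological_space, 'e::euclidean_space) chart set \<Rightarrow> ('x, 'e) metric_tensor
     \<Rightarrow> 'x \<Rightarrow> (real \<Rightarrow> 'x) set \<Rightarrow> 'x \<Rightarrow> real" where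
  "busemann A g org \<xi> x = Lim at_top (\<lambda>t. riem_dist A g (ray_from org \<xi> t) x - t)"

definition horo_halfspace ::
  "('x::topological_space, 'e::euclidean_space) chart set \<Rightarrow> ('x, 'e) metric_tensor
     \<Rightarrow> 'x \<Rightarrow> (real \<Rightarrow> 'x) set \<Rightarrow> 'x \<Rightarrow> 'x set" where
  "horo_halfspace A g org \<xi> z = {x. busemann A g org \<xi> x \<ge> busemann A g org \<xi> z}"

definition horo_depth ::
  "('x::topological_space, 'e::euclidean_space) chart set \<Rightarrow> ('x, 'e) metric_tensor
     \<Rightarrow> 'x \<Rightarrow> 'x \<Rightarrow> 'x measure \<Rightarrow> real" where
  "horo_depth A g org z P = (INF \<xi>\<in>visual_boundary A g. measure P (horo_halfspace A g org \<xi> z))"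

definition tv_dist :: "'x::topological_space measure \<Rightarrow> 'x measure \<Rightarrow> real" where
  "tv_dist P Q = (SUP S\<in>sets borel. \<bar>measure P S - measure Q S\<bar>)"

end

theory Submission
  imports Defs
begin

text \<open>The total variation distance bounds the difference of the two masses of every horospherical
  half-space, uniformly in the boundary point. The depth is the infimum of these masses, and taking
  an infimum is 1-Lipschitz for the uniform distance of bounded families (\<open>cINF_abs_diff_le\<close>), so
  the two depths differ by no more than that bound.

  Two points concern the totality of the functions involved. \<^const>\<open>measure\<close> is defined on all
  sets, with value 0 on the non-measurable ones, so that the bound on masses holds for every set
  (\<open>abs_measure_diff_le_tv_dist\<close>). If the visual boundary is empty, both depths are the infimum of
  the empty set, hence equal.\<close>

lemma cINF_le_cINF_plus:
  fixes f h :: "'i \<Rightarrow> real"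
  assumes "I \<noteq> {}" and "bdd_below (f ` I)" and "\<And>i. i \<in> I \<Longrightarrow> f i \<le> h i + c"
  shows "(INF i\<in>I. f i) \<le> (INF i\<in>I. h i) + c"
proof -
  have "(INF i\<in>I. f i) - c \<le> h i" if "i \<in> I" for i
    using cINF_lower[OF assms(2) that] assms(3)[OF that] by linarith
  then have "(INF i\<in>I. f i) - c \<le> (INF i\<in>I. h i)"
    by (rule cINF_greatest[OF assms(1)])
  then show ?thesis by linarith
qed

lemma cINF_abs_diff_le:
  fixes f h :: "'i \<Rightarrow> real"
  assumes "I \<noteq> {}" and "bdd_below (f ` I)" and "bdd_below (h ` I)"
    and "\<And>i. i \<in> I \<Longrightarrow> \<bar>f i - h i\<bar> \<le> c"
  shows "\<bar>(INF i\<in>I. f i) - (INF i\<in>I. h i)\<bar> \<le> c"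
proof -
  have "f i \<le> h i + c" "h i \<le> f i + c" if "i \<in> I" for i
    using assms(4)[OF that] by linarith+
  then have "(INF i\<in>I. f i) \<le> (INF i\<in>I. h i) + c" "(INF i\<in>I. h i) \<le> (INF i\<in>I. f i) + c"
    using assms(1-3) by (auto intro!: cINF_le_cINF_plus)
  then show ?thesis by linarith
qed

text \<open>For a Borel set \<open>S\<close> the difference is one of the numbers of which \<^const>\<open>tv_dist\<close> is the
  supremum, and these numbers are bounded by 1. For any other \<open>S\<close> both masses are 0, and the
  bound is the case of the empty set.\<close>

lemma abs_measure_diff_le_tv_dist:
  assumes "prob_space P" and "sets P = sets borel"
    and "prob_space Q" and "sets Q = sets borel"
  shows "\<bar>measure P S - measure Q S\<bar> \<le> tv_dist P Q"
proof -
  interpret P: prob_space P by fact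
  interpret Q: prob_space Q by fact
  have "\<bar>measure P B - measure Q B\<bar> \<le> 1" for B
    using P.prob_le_1[of B] Q.prob_le_1[of B] measure_nonneg[of P B] measure_nonneg[of Q B]
    by linarith
  then have "bdd_above ((\<lambda>B. \<bar>measure P B - measure Q B\<bar>) ` sets borel)"
    by (intro bdd_aboveI2)
  then have borel: "\<bar>measure P B - measure Q B\<bar> \<le> tv_dist P Q" if "B \<in> sets borel" for B
    unfolding tv_dist_def by (rule cSUP_upper[OF that])
  show ?thesis
  proof (cases "S \<in> sets borel")
    case True
    then show ?thesis by (rule borel)
  next
    case False
    then have "measure P S = measure P {}" "measure Q S = measure Q {}"
      using assms(2,4) by (simp_all add: measure_notin_sets)
    then show ?thesis using borel[of "{}"] by simp
  qed
qed

theorem theorem7p1: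
  fixes A :: "('x::{t2_space, second_countable_topology}, 'e::euclidean_space) chart set"
    and g :: "('x, 'e) metric_tensor"
    and org z :: 'x
    and P Q :: "'x measure"
  assumes "hadamard_manifold A g"
    and "prob_space P" and "sets P = sets borel"
    and "prob_space Q" and "sets Q = sets borel"
  shows "\<bar>horo_depth A g org z P - horo_depth A g org z Q\<bar> \<le> tv_dist P Q"
proof (cases "visual_boundary A g = {}")
  case True
  moreover have "0 \<le> tv_dist P Q"
    using abs_measure_diff_le_tv_dist[OF assms(2-5), of "{}"] by simp
  ultimately show ?thesis by (simp add: horo_depth_def)
next
  case False
  have "bdd_below ((\<lambda>\<xi>. measure M (horo_halfspace A g org \<xi> z)) ` visual_boundary A g)" for M
    by (rule bdd_belowI2[where m = 0]) simp
  with False show ?thesis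
    unfolding horo_depth_def
    by (intro cINF_abs_diff_le abs_measure_diff_le_tv_dist assms)
qed

end
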